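(* Let $(Q,Q')$ be a completely extended linear quiver with $n=|Q_0|\ge2$. Let $\mathcal{M}$ be the set of perfect matchings of the associated snake diagram, and $\mathcal{G}$ the set of GCCs. Define $\psi_{\mathcal{M},\mathcal{G}}:\mathcal{M}\to\mathcal{G}$ by sending $\gamma$ to the collection $\{S_{i,r}\}$ with, for $i\in[1,n-1]$: - $(|S_{i,1}|,|S_{i,2}|)=(\delta_i,1-\delta_i)$ if $T^{(i)}_i\in\gamma$; - $(|S_{i,1}|,|S_{i,2}|)=(1-\delta_i,\delta_i)$ if $T^{(i)}_{i+1}\in\gamma$; - $(|S_{i,1}|,|S_{i,2}|)=(0,0)$ if $T_{i,i+1}\in\gamma$. Define $\psi_{\mathcal{G},\mathcal{M}}:\mathcal{G}\to\mathcal{M}$ by sending $\{S_{i,r}\}$ to the edge set $\gamma=\{\gamma_0,\dots,\gamma_n\}$ with, for $i\in[1,n-1]$: - $\gamma_i=T^{(i)}_i$ if $(|S_{i,1}|,|S_{i,2}|)=(\delta_i,1-\delta_i)$; - $\gamma_i=T^{(i)}_{i+1}$ if it equals $(1-\delta_i,\delta_i)$; - $\gamma_i=T_{i,i+1}$ if it equals $(0,0)$. Further, $\gamma_0=T_{1,0}$ if $|S_{1,1+\delta_1}|=1-\delta_1$ and $\gamma_0=T_{1,1}$ otherwise; $\gamma_n=T_{n,0}$ if $|S_{n-1,2-\delta_{n-1}}|=\delta_{n-1}$ and $\gamma_n=T_{n,1}$ otherwise. Then $\psi_{\mathcal{M},\mathcal{G}}$ and $\psi_{\mathcal{G},\mathcal{M}}$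 are well defined, i.e. they take values in $\mathcal{G}$ and $\mathcal{M}$ respectively, and they are inverse to each other. Moreover, for every GCC with $\psi_{\mathcal{G},\mathcal{M}}(\{S_{i,r}\})=\{\gamma_0,\dots,\gamma_n\}$, one has $w(\gamma_i)=y_i$ for all $i\in[0,n]$. In particular $\sum_{\gamma\in\mathcal{M}}\prod_{i=0}^n w(\gamma_i)=\sum_{\{S_{i,r}\}\in\mathcal{G}}\prod_{i=0}^n y_i$.
   Context: A linear quiver $Q$ has vertices $v_1,\dots,v_n$ (identified with $1,\dots,n$) and exactly one arrow between $v_i$ and $v_{i+1}$ for each $i\in[1,n-1]$, and no other arrows. Set $\delta_i=0$ if the arrow is $v_i\to v_{i+1}$ and $\delta_i=1$ otherwise. The completely extended linear quiver $Q'$ adds: - a vertex $v_{i,i+1}$ forming an oriented $3$-cycle with $v_i,v_{i+1}$, for each $i$; - vertices $v_{1,0},v_{1,1}$ with $v_1\to v_{1,0}\to v_{1,1}\to v_1$; - vertices $v_{n,0},v_{n,1}$ with $v_n\to v_{n,0}\to v_{n,1}\to v_n$. Formal variables $x_i,x_{i,i+1},x_{1,0},x_{1,1},x_{n,0},x_{n,1}$ are attached to these vertices. GCC: for $i\in[1,n-1]$, let $S_{i,1}$ be a subset of a one-element set $\{u^{(i)}\}$ and $S_{i,2}$ a subset of a one-element set $\{v^{(i)}\}$. The collection $\{S_{i,r}\}$ is a GCC if $(|S_{i,1}|,|S_{i,2}|)\ne(1,1)$ for all $i$, and for $i\in[2,n-1]$: - if $(\delta_{i-1},\delta_i)=(0,0)$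 then $|S_{i-1,2}|\ne|S_{i,1}|$; - if $(1,1)$ then $|S_{i-1,1}|\ne|S_{i,2}|$; - if $(0,1)$ then $|S_{i-1,2}|=|S_{i,2}|$; - if $(1,0)$ then $|S_{i-1,1}|=|S_{i,1}|$. For a GCC, define $y_i=x_{i+\delta_i}^{|S_{i,2}|}x_{i+1-\delta_i}^{|S_{i,1}|}x_{i,i+1}^{1-|S_{i,1}|-|S_{i,2}|}$ for $i\in[1,n-1]$. Set $y_0=x_{1,0}$ if $|S_{1,1+\delta_1}|=1-\delta_1$, else $x_{1,1}$. Set $y_n=x_{n,0}$ if $|S_{n-1,2-\delta_{n-1}}|=\delta_{n-1}$, else $x_{n,1}$. Snake diagram: a planar graph made of $n$ unit-square tiles $G_1,\dots,G_n$. $G_2$ is glued to the right of $G_1$. For $i\in[2,n-1]$, $G_{i+1}$ is glued either to the right of or on top of $G_i$, chosen so that $G_{i-1},G_i,G_{i+1}$ lie in one row or one column iff $\delta_{i-1}\ne\delta_i$. Its vertices are the tile corners and its edges are the tile sides. In each tile, the main diagonal joins the top-left and bottom-right corners. It splits the sides into a lower-left pair (bottom, left) and an upper-right pair (top, right). For $i\in[1,n-1]$, the common side of $G_i$ and $G_{i+1}$ is labelled $T_{i,i+1}$. The other upper-right side of $G_i$ is labelled $T^{(i)}_{i+1}$, and the other lower-left side of $G_{i+1}$ is labelled $T^{(i)}_i$. The bottom of $G_1$ is labelled $T_{1,\delta_1}$ and its left side $T_{1,1-\delta_1}$. If $G_n$ is to the right of $G_{n-1}$, its right side is $T_{n,\delta_{n-1}}$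 and its top is $T_{n,1-\delta_{n-1}}$. If $G_n$ is on top of $G_{n-1}$, its right side is $T_{n,1-\delta_{n-1}}$ and its top is $T_{n,\delta_{n-1}}$. A perfect matching is a set of edges such that every vertex lies on exactly one of them. Weights: $w(T^{(i)}_j)=x_j$, $w(T_{j,j+1})=x_{j,j+1}$, and $w(T_{1,0})=x_{1,0}$, $w(T_{1,1})=x_{1,1}$, $w(T_{n,0})=x_{n,0}$, $w(T_{n,1})=x_{n,1}$. *)

theory Defs
  imports
    "HOL-Library.FuncSet"
    "HOL-Library.Poly_Mapping"
    "Graph_Theory.Digraph_Component"
begin

section \<open>Completely extended linear quivers\<close>

text \<open>
  \<open>Vtx i\<close> is $v_i$ and \<open>Vtx2 i j\<close> is $v_{i,j}$; so \<open>Vtx2 i (i + 1)\<close> is $v_{i,i+1}$ for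
  $1 \le i < n$, and \<open>Vtx2 1 0\<close>, \<open>Vtx2 1 1\<close>, \<open>Vtx2 n 0\<close>, \<open>Vtx2 n 1\<close> are the four
  vertices added at the two ends. These are pairwise distinct because $n \ge 2$ throughout.
\<close>

datatype qvertex = Vtx nat | Vtx2 nat nat

definition linear_quiver :: "nat \<Rightarrow> (qvertex, 'a) pre_digraph \<Rightarrow> bool" where
  "linear_quiver n Q \<longleftrightarrow>
     wf_digraph Q \<and>
     verts Q = Vtx ` {1..n} \<and>
     (\<forall>i\<in>{1..<n}. \<exists>!a. a \<in> arcs Q \<and> {tail Q a, head Q a} = {Vtx i, Vtx (i + 1)}) \<and>
     (\<forall>a\<in>arcs Q. \<exists>i\<in>{1..<n}. {tail Q a, head Q a} = {Vtx i, Vtx (i + 1)})"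

definition delta :: "(qvertex, 'a) pre_digraph \<Rightarrow> nat \<Rightarrow> nat" where
  "delta Q i = (if \<exists>a\<in>arcs Q. tail Q a = Vtx i \<and> head Q a = Vtx (i + 1) then 0 else 1)"

definition added_verts :: "nat \<Rightarrow> qvertex set" where
  "added_verts n = {Vtx2 i (i + 1) |i. i \<in> {1..<n}} \<union> {Vtx2 1 0, Vtx2 1 1, Vtx2 n 0, Vtx2 n 1}"

definition added_ends :: "nat \<Rightarrow> (qvertex, 'a) pre_digraph \<Rightarrow> (qvertex \<times> qvertex) set" where
  "added_ends n Q =
     (\<Union>i\<in>{1..<n}.
        if delta Q i = 0
        then {(Vtx (i + 1), Vtx2 i (i + 1)), (Vtx2 i (i + 1), Vtx i)}
        else {(Vtx i, Vtx2 i (i + 1)), (Vtx2 i (i + 1), Vtx (i + 1))}) \<union>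
     (\<Union>j\<in>{1, n}. {(Vtx j, Vtx2 j 0), (Vtx2 j 0, Vtx2 j 1), (Vtx2 j 1, Vtx j)})"

text \<open>
  The bijection says that the arrows of \<open>Q'\<close> outside \<open>Q\<close> are exactly one for each of the listed
  (source, target) pairs.
\<close>

definition completely_extended_linear_quiver ::
    "nat \<Rightarrow> (qvertex, 'a) pre_digraph \<Rightarrow> (qvertex, 'a) pre_digraph \<Rightarrow> bool" where
  "completely_extended_linear_quiver n Q Q' \<longleftrightarrow>
     linear_quiver n Q \<and>
     subgraph Q Q' \<and>
     verts Q' = verts Q \<union> added_verts n \<and>
     bij_betw (arc_to_ends Q') (arcs Q' - arcs Q) (added_ends n Q)"

text \<open>Polynomials in formal variables attached to the vertices, with coefficients in \<open>'k\<close>.\<close>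

type_synonym 'k qpoly = "(qvertex \<Rightarrow>\<^sub>0 nat) \<Rightarrow>\<^sub>0 'k"

definition qvar :: "qvertex \<Rightarrow> 'k::comm_ring_1 qpoly" where
  "qvar p = Poly_Mapping.single (Poly_Mapping.single p 1) 1"


section \<open>GCCs\<close>

text \<open>
  A collection $\{S_{i,r}\}$ is an extensional function on the index set
  $[1,n-1] \times \{1,2\}$ (so that equality of collections is equality of functions).
\<close>

definition collections :: "nat \<Rightarrow> (nat \<Rightarrow> 'e) \<Rightarrow> (nat \<Rightarrow> 'e) \<Rightarrow> (nat \<times> nat \<Rightarrow> 'e set) set" where
  "collections n u v =
     (\<Pi>\<^sub>E (i, r)\<in>{1..<n} \<times> {1, 2}. if r = 1 then Pow {u i} else Pow {v i})"

definition gccs ::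
    "nat \<Rightarrow> (nat \<Rightarrow> nat) \<Rightarrow> (nat \<Rightarrow> 'e) \<Rightarrow> (nat \<Rightarrow> 'e) \<Rightarrow> (nat \<times> nat \<Rightarrow> 'e set) set" where
  "gccs n \<delta> u v =
     {S \<in> collections n u v.
        (\<forall>i\<in>{1..n-1}. (card (S (i, 1)), card (S (i, 2))) \<noteq> (1, 1)) \<and>
        (\<forall>i\<in>{2..n-1}.
           ((\<delta> (i - 1), \<delta> i) = (0, 0) \<longrightarrow> card (S (i - 1, 2)) \<noteq> card (S (i, 1))) \<and>
           ((\<delta> (i - 1), \<delta> i) = (1, 1) \<longrightarrow> card (S (i - 1, 1)) \<noteq> card (S (i, 2))) \<and>
           ((\<delta> (i - 1), \<delta> i) = (0, 1) \<longrightarrow> card (S (i - 1, 2)) = card (S (i, 2))) \<and>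
           ((\<delta> (i - 1), \<delta> i) = (1, 0) \<longrightarrow> card (S (i - 1, 1)) = card (S (i, 1))))}"

definition gcc_y ::
    "nat \<Rightarrow> (nat \<Rightarrow> nat) \<Rightarrow> (nat \<times> nat \<Rightarrow> 'e set) \<Rightarrow> nat \<Rightarrow> 'k::comm_ring_1 qpoly" where
  "gcc_y n \<delta> S i =
     (if i = 0 then
        (if card (S (1, 1 + \<delta> 1)) = 1 - \<delta> 1 then qvar (Vtx2 1 0) else qvar (Vtx2 1 1))
      else if i = n then
        (if card (S (n - 1, 2 - \<delta> (n - 1))) = \<delta> (n - 1)
         then qvar (Vtx2 n 0) else qvar (Vtx2 n 1))
      else
        qvar (Vtx (i + \<delta> i)) ^ card (S (i, 2)) *
        qvar (Vtx (i + 1 - \<delta> i)) ^ card (S (i, 1)) *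
        qvar (Vtx2 i (i + 1)) ^ (1 - card (S (i, 1)) - card (S (i, 2))))"


section \<open>The snake diagram\<close>

text \<open>
  The diagram is drawn in the plane with all tile corners at lattice points. A point is a pair
  of coordinates, a tile is named by its lower left corner, and an edge is the set of its two
  end points. As the diagram only grows to the right and upwards, two tiles share a corner or
  a side in the plane only if the gluing identifies them.
\<close>

type_synonym point = "nat \<times> nat"
type_synonym edge = "point set"

fun bottom_side :: "point \<Rightarrow> edge" where
  "bottom_side (a, b) = {(a, b), (a + 1, b)}"

fun left_side :: "point \<Rightarrow> edge" where
  "left_side (a, b) = {(a, b), (a, b + 1)}"

fun top_side :: "point \<Rightarrow> edge" where
  "top_side (a, b) = {(a, b + 1), (a + 1, b + 1)}"

fun right_side :: "point \<Rightarrow> edge" where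
  "right_side (a, b) = {(a + 1, b), (a + 1, b + 1)}"

fun corners :: "point \<Rightarrow> point set" where
  "corners (a, b) = {(a, b), (a + 1, b), (a, b + 1), (a + 1, b + 1)}"

definition sides :: "point \<Rightarrow> edge set" where
  "sides p = {bottom_side p, left_side p, top_side p, right_side p}"

text \<open>
  \<open>glue_right \<delta> i\<close>: the tile $G_{i+1}$ is glued to the right of $G_i$ (otherwise on top of it).
  The values at \<open>0\<close> here and in \<open>tile\<close> are irrelevant.
\<close>

fun glue_right :: "(nat \<Rightarrow> nat) \<Rightarrow> nat \<Rightarrow> bool" where
  "glue_right \<delta> 0 = True"
| "glue_right \<delta> (Suc 0) = True"
| "glue_right \<delta> (Suc (Suc i)) =
     (if \<delta> (Suc i) \<noteq> \<delta> (Suc (Suc i)) then glue_right \<delta> (Suc i) else \<not> glue_right \<delta> (Suc i))"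

fun tile :: "(nat \<Rightarrow> nat) \<Rightarrow> nat \<Rightarrow> point" where
  "tile \<delta> 0 = (0, 0)"
| "tile \<delta> (Suc 0) = (0, 0)"
| "tile \<delta> (Suc (Suc i)) =
     (case tile \<delta> (Suc i) of (a, b) \<Rightarrow> if glue_right \<delta> (Suc i) then (a + 1, b) else (a, b + 1))"

definition snake_verts :: "nat \<Rightarrow> (nat \<Rightarrow> nat) \<Rightarrow> point set" where
  "snake_verts n \<delta> = (\<Union>i\<in>{1..n}. corners (tile \<delta> i))"

definition snake_edges :: "nat \<Rightarrow> (nat \<Rightarrow> nat) \<Rightarrow> edge set" where
  "snake_edges n \<delta> = (\<Union>i\<in>{1..n}. sides (tile \<delta> i))"

definition perfect_matchings :: "'p set \<Rightarrow> 'p set set \<Rightarrow> 'p set set set" where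
  "perfect_matchings V E = {M. M \<subseteq> E \<and> (\<forall>p\<in>V. \<exists>!e. e \<in> M \<and> p \<in> e)}"

definition snake_matchings :: "nat \<Rightarrow> (nat \<Rightarrow> nat) \<Rightarrow> edge set set" where
  "snake_matchings n \<delta> = perfect_matchings (snake_verts n \<delta>) (snake_edges n \<delta>)"

text \<open>\<open>T i j\<close> is the label $T_{i,j}$ and \<open>Tsup i j\<close> is the label $T^{(i)}_j$.\<close>

datatype label = T nat nat | Tsup nat nat

definition labels :: "nat \<Rightarrow> label set" where
  "labels n =
     {T 1 0, T 1 1, T n 0, T n 1} \<union> {T i (i + 1) |i. i \<in> {1..<n}} \<union>
     {Tsup i i |i. i \<in> {1..<n}} \<union> {Tsup i (i + 1) |i. i \<in> {1..<n}}"

text \<open>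
  The edge carrying a given label; the labels at the two ends are $T_{1,k}$ and $T_{n,k}$ with
  $k \in \{0,1\}$. If $G_{i+1}$ is to the right of $G_i$, the common side is the right side of $G_i$,
  so the other upper right side of $G_i$ is its top and the other lower left side of $G_{i+1}$ is
  its bottom; if $G_{i+1}$ is on top of $G_i$, these are the right side and the left side.
\<close>

fun labelled_edge :: "nat \<Rightarrow> (nat \<Rightarrow> nat) \<Rightarrow> label \<Rightarrow> edge" where
  "labelled_edge n \<delta> (T i j) =
     (if i = 1 \<and> j \<in> {0, 1} then
        (if j = \<delta> 1 then bottom_side (tile \<delta> 1) else left_side (tile \<delta> 1))
      else if i = n \<and> j \<in> {0, 1} then
        (if glue_right \<delta> (n - 1)
         then (if j = \<delta> (n - 1) then right_side (tile \<delta> n) else top_side (tile \<delta> n))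
         else (if j = \<delta> (n - 1) then top_side (tile \<delta> n) else right_side (tile \<delta> n)))
      else
        (if glue_right \<delta> i then right_side (tile \<delta> i) else top_side (tile \<delta> i)))"
| "labelled_edge n \<delta> (Tsup i j) =
     (if j = i + 1
      then (if glue_right \<delta> i then top_side (tile \<delta> i) else right_side (tile \<delta> i))
      else (if glue_right \<delta> i then bottom_side (tile \<delta> (i + 1)) else left_side (tile \<delta> (i + 1))))"

fun label_weight :: "label \<Rightarrow> 'k::comm_ring_1 qpoly" where
  "label_weight (T i j) = qvar (Vtx2 i j)"
| "label_weight (Tsup i j) = qvar (Vtx j)"

text \<open>Every edge of the diagram carries exactly one label, and it gets the weight of that label.\<close>

definition edge_weight :: "nat \<Rightarrow> (nat \<Rightarrow> nat) \<Rightarrow> edge \<Rightarrow> 'k::comm_ring_1 qpoly" where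
  "edge_weight n \<delta> e = label_weight (inv_into (labels n) (labelled_edge n \<delta>) e)"


section \<open>The maps between perfect matchings and GCCs\<close>

text \<open>The cardinalities $(|S_{i,1}|,|S_{i,2}|)$ of the image of a matching.\<close>

definition matching_cards :: "nat \<Rightarrow> (nat \<Rightarrow> nat) \<Rightarrow> edge set \<Rightarrow> nat \<Rightarrow> nat \<times> nat" where
  "matching_cards n \<delta> \<gamma> i =
     (if labelled_edge n \<delta> (Tsup i i) \<in> \<gamma> then (\<delta> i, 1 - \<delta> i)
      else if labelled_edge n \<delta> (Tsup i (i + 1)) \<in> \<gamma> then (1 - \<delta> i, \<delta> i)
      else (0, 0))"

text \<open>A subset of a one-element set is determined by its cardinality.\<close>

definition psi_MG ::
    "nat \<Rightarrow> (nat \<Rightarrow> nat) \<Rightarrow> (nat \<Rightarrow> 'e) \<Rightarrow> (nat \<Rightarrow> 'e) \<Rightarrow> edge set \<Rightarrow> (nat \<times> nat \<Rightarrow> 'e set)" where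
  "psi_MG n \<delta> u v \<gamma> =
     (\<lambda>(i, r)\<in>{1..<n} \<times> {1, 2}.
        if r = 1
        then (if fst (matching_cards n \<delta> \<gamma> i) = 1 then {u i} else {})
        else (if snd (matching_cards n \<delta> \<gamma> i) = 1 then {v i} else {}))"

definition matching_edge ::
    "nat \<Rightarrow> (nat \<Rightarrow> nat) \<Rightarrow> (nat \<times> nat \<Rightarrow> 'e set) \<Rightarrow> nat \<Rightarrow> edge" where
  "matching_edge n \<delta> S i = labelled_edge n \<delta>
     (if i = 0 then (if card (S (1, 1 + \<delta> 1)) = 1 - \<delta> 1 then T 1 0 else T 1 1)
      else if i = n then
        (if card (S (n - 1, 2 - \<delta> (n - 1))) = \<delta> (n - 1) then T n 0 else T n 1)
      else if (card (S (i, 1)), card (S (i, 2))) = (\<delta> i, 1 - \<delta> i) then Tsup i i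
      else if (card (S (i, 1)), card (S (i, 2))) = (1 - \<delta> i, \<delta> i) then Tsup i (i + 1)
      else T i (i + 1))"

definition psi_GM :: "nat \<Rightarrow> (nat \<Rightarrow> nat) \<Rightarrow> (nat \<times> nat \<Rightarrow> 'e set) \<Rightarrow> edge set" where
  "psi_GM n \<delta> S = matching_edge n \<delta> S ` {0..n}"

end

theory Submission
  imports Defs
begin

text \<open>
  Grade the vertices of the snake diagram by the sum of their coordinates. Each of the levels
  \<open>1, \<dots>, n\<close> consists of the two ends of the main diagonal of one tile, the levels \<open>0\<close> and \<open>n + 1\<close>
  of a single vertex, and every edge joins two consecutive levels. Hence a perfect matching has
  exactly one edge between any two consecutive levels, and it is determined by the bits \<open>s i\<close> saying
  which of the two vertices of level \<open>i\<close> is covered from below. Between the levels \<open>i\<close> and \<open>i + 1\<close>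
  only one of the four conceivable edges is absent, which excludes precisely
  \<open>s i = s (i + 1) = g i\<close>, where \<open>g i\<close> says that the next tile is glued to the right. GCCs are
  encoded by the same bit sequences: the cardinalities of the two sets at \<open>i\<close> are, in an order given
  by \<open>\<delta> i\<close>, the truth values of \<open>s i = g i\<close> and \<open>s (i + 1) = g i\<close>. Both maps of the theorem become
  the identity on bit sequences.
\<close>

locale snake_diagram =
  fixes n :: nat and \<delta> :: "nat \<Rightarrow> nat"
  assumes two_le_n: "2 \<le> n" and delta_cases: "\<delta> i = 0 \<or> \<delta> i = 1"
begin

section \<open>Coordinates by level for vertices and edges of the diagram\<close>

abbreviation g :: "nat \<Rightarrow> bool" where "g \<equiv> glue_right \<delta>"

text \<open>
  The vertices of level \<open>i\<close>; \<open>True\<close> stands for the lower right end of the diagonal of tile \<open>i\<close>, and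
  the bit is ignored at the levels \<open>0\<close> and \<open>n + 1\<close>.
\<close>

definition vert :: "nat \<Rightarrow> bool \<Rightarrow> point" where
  "vert i p = (if i = 0 then (0, 0) else case tile \<delta> (min i n) of (a, b) \<Rightarrow>
     if n < i then (a + 1, b + 1) else if p then (a + 1, b) else (a, b + 1))"

lemma tile_level: "fst (tile \<delta> (Suc i)) + snd (tile \<delta> (Suc i)) = i"
  by (induction i) (auto split: prod.splits)

lemma vert_level: "i \<le> Suc n \<Longrightarrow> fst (vert i p) + snd (vert i p) = i"
  using tile_level[of "i - 1"] tile_level[of "n - 1"] two_le_n
  by (cases "i = Suc n") (auto simp: vert_def split: prod.splits)

lemma vert_eq_iff [simp]:
  assumes "i \<le> Suc n" "j \<le> Suc n"
  shows "vert i p = vert j q \<longleftrightarrow> i = j \<and> (i = 0 \<or> i = Suc n \<or> p = q)"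
proof (cases "i = j")
  case True
  then show ?thesis
    using assms by (auto simp: vert_def split: prod.splits)
next
  case False
  then show ?thesis
    using vert_level[OF assms(1), of p] vert_level[OF assms(2), of q] by auto
qed

text \<open>This names every conceivable edge between consecutive levels, also those that are a side
  of no tile; \<open>snake_edges_eq\<close> sorts these out.\<close>

definition seg :: "nat \<Rightarrow> bool \<Rightarrow> bool \<Rightarrow> edge" where
  "seg i p q = {vert i p, vert (Suc i) q}"

lemma seg_eq_iff [simp]:
  "i \<le> n \<Longrightarrow> j \<le> n \<Longrightarrow>
     seg i p q = seg j p' q' \<longleftrightarrow> i = j \<and> (i = 0 \<or> p = p') \<and> (i = n \<or> q = q')"
  by (auto simp: seg_def doubleton_eq_iff)

lemma vert_in_seg_iff [simp]:
  "i \<le> n \<Longrightarrow> j \<le> Suc n \<Longrightarrow>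
     vert j r \<in> seg i p q \<longleftrightarrow> j = i \<and> (i = 0 \<or> r = p) \<or> j = Suc i \<and> (i = n \<or> r = q)"
  by (auto simp: seg_def)

text \<open>Gluing to the right turns the lower right corner of the previous tile into the new lower
  left corner, gluing on top does so with the upper left corner. For \<open>i = 1\<close> the bit is
  ignored.\<close>

lemma tile_eq_vert: "1 \<le> i \<Longrightarrow> i \<le> n \<Longrightarrow> tile \<delta> i = vert (i - 1) (g (i - 1))"
  by (cases "(\<delta>, i)" rule: tile.cases) (auto simp: vert_def split: prod.splits)

text \<open>If the next tile lies to the right, this corner is its upper left one, otherwise its
  lower right one; hence the negation.\<close>

lemma upper_right_eq_vert:
  assumes "1 \<le> i" "i \<le> n"
  shows "(fst (tile \<delta> i) + 1, snd (tile \<delta> i) + 1) = vert (Suc i) (\<not> g i)"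
proof (cases "i = n")
  case True
  then show ?thesis by (simp add: vert_def case_prod_beta)
next
  case False
  then have "tile \<delta> (Suc i) = (if g i then (fst (tile \<delta> i) + 1, snd (tile \<delta> i))
      else (fst (tile \<delta> i), snd (tile \<delta> i) + 1))" "Suc i \<le> n"
    using assms by (cases i; simp add: case_prod_beta)+
  then show ?thesis by (simp add: vert_def)
qed

lemma diagonal_eq_vert:
  assumes "1 \<le> i" "i \<le> n"
  shows "(fst (tile \<delta> i) + 1, snd (tile \<delta> i)) = vert i True"
    and "(fst (tile \<delta> i), snd (tile \<delta> i) + 1) = vert i False"
  using assms by (auto simp: vert_def split: prod.splits)

lemma tile_sides:
  assumes "1 \<le> i" "i \<le> n"
  shows "bottom_side (tile \<delta> i) = seg (i - 1) (g (i - 1)) True"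
    and "left_side (tile \<delta> i) = seg (i - 1) (g (i - 1)) False"
    and "right_side (tile \<delta> i) = seg i True (\<not> g i)"
    and "top_side (tile \<delta> i) = seg i False (\<not> g i)"
proof -
  obtain a b where ab: "tile \<delta> i = (a, b)" by fastforce
  then have "(a, b) = vert (i - 1) (g (i - 1))" "(a + 1, b) = vert i True"
      "(a, b + 1) = vert i False" "(a + 1, b + 1) = vert (Suc i) (\<not> g i)"
    using tile_eq_vert[OF assms] diagonal_eq_vert[OF assms] upper_right_eq_vert[OF assms] by auto
  then show "bottom_side (tile \<delta> i) = seg (i - 1) (g (i - 1)) True"
    "left_side (tile \<delta> i) = seg (i - 1) (g (i - 1)) False"
    "right_side (tile \<delta> i) = seg i True (\<not> g i)"
    "top_side (tile \<delta> i) = seg i False (\<not> g i)"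
    unfolding ab seg_def bottom_side.simps left_side.simps right_side.simps top_side.simps
    using assms by simp_all
qed

lemma tile_corners:
  assumes "1 \<le> i" "i \<le> n"
  shows "corners (tile \<delta> i) =
    {vert (i - 1) (g (i - 1)), vert i True, vert i False, vert (Suc i) (\<not> g i)}"
  using tile_eq_vert[OF assms] diagonal_eq_vert[OF assms] upper_right_eq_vert[OF assms]
  by (metis corners.simps prod.collapse)

lemma snake_verts_eq: "snake_verts n \<delta> = {vert i p |i p. i \<le> Suc n}"
proof (intro equalityI subsetI)
  fix x assume "x \<in> snake_verts n \<delta>"
  then obtain i where i: "1 \<le> i" "i \<le> n" and "x \<in> corners (tile \<delta> i)"
    by (auto simp: snake_verts_def)
  then have "x \<in> {vert (i - 1) (g (i - 1)), vert i True, vert i False, vert (Suc i) (\<not> g i)}"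
    using tile_corners by simp
  moreover have "i - 1 \<le> Suc n" "i \<le> Suc n" "Suc i \<le> Suc n"
    using i by auto
  ultimately show "x \<in> {vert i p |i p. i \<le> Suc n}"
    by blast
next
  fix x assume "x \<in> {vert i p |i p. i \<le> Suc n}"
  then obtain i p where i: "i \<le> Suc n" and x: "x = vert i p" by auto
  have v: "j \<in> {1..n} \<Longrightarrow> y \<in> corners (tile \<delta> j) \<Longrightarrow> y \<in> snake_verts n \<delta>" for j y
    by (auto simp: snake_verts_def)
  consider "i = 0" | "1 \<le> i" "i \<le> n" | "i = Suc n" using i by linarith
  then show "x \<in> snake_verts n \<delta>"
  proof cases
    case 1
    then show ?thesis using two_le_n x by (intro v[of 1]) (auto simp: vert_def)
  next
    case 2
    then show ?thesis using x by (intro v[of i]) (cases p; auto simp: tile_corners)+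
  next
    case 3
    then show ?thesis using two_le_n x by (intro v[of n]) (auto simp: tile_corners)
  qed
qed

text \<open>Between levels \<open>i\<close> and \<open>Suc i\<close> run the lower left sides of
  tile \<open>Suc i\<close>, which start at bit \<open>g i\<close>, and the upper right sides of
  tile \<open>i\<close>, which end at bit \<open>\<not> g i\<close>. At the two extreme levels only
  one of the tiles exists, but there one bit is ignored and nothing is missing.\<close>

lemma snake_edges_eq:
  "snake_edges n \<delta> = {seg i p q |i p q. i \<le> n \<and> (p = g i \<or> q = (\<not> g i) \<or> i = 0 \<or> i = n)}"
  (is "_ = ?E")
proof (intro equalityI subsetI)
  fix e assume "e \<in> snake_edges n \<delta>"
  then obtain i where i: "1 \<le> i" "i \<le> n" and "e \<in> sides (tile \<delta> i)"
    by (auto simp: snake_edges_def)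
  then have "e \<in> {seg (i - 1) (g (i - 1)) True, seg (i - 1) (g (i - 1)) False,
      seg i True (\<not> g i), seg i False (\<not> g i)}"
    by (auto simp: sides_def tile_sides)
  moreover have "i - 1 \<le> n" using i by simp
  ultimately show "e \<in> ?E" using i by blast
next
  fix e assume "e \<in> ?E"
  then obtain i p q where i: "i \<le> n" and e: "e = seg i p q"
    and pq: "p = g i \<or> q = (\<not> g i) \<or> i = 0 \<or> i = n"
    by auto
  have v: "j \<in> {1..n} \<Longrightarrow> y \<in> sides (tile \<delta> j) \<Longrightarrow> y \<in> snake_edges n \<delta>" for j y
    by (auto simp: snake_edges_def)
  consider (lower) "i < n" "i = 0 \<or> p = g i" | (upper) "0 < i" "i = n \<or> q = (\<not> g i)"
    using i pq two_le_n by linarith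
  then show "e \<in> snake_edges n \<delta>"
  proof cases
    case lower
    then have "e = seg i (g i) q" using e i by auto
    then show ?thesis
      using lower by (intro v[of "Suc i"]) (cases q; auto simp: sides_def tile_sides)+
  next
    case upper
    then have "e = seg i p (\<not> g i)" using e i by auto
    then show ?thesis
      using upper i by (intro v[of i]) (cases p; auto simp: sides_def tile_sides)+
  qed
qed

section \<open>Labels and weights of the edges\<close>

text \<open>Relative to \<open>g i\<close> both gluing directions give the same formula. Together
  with \<open>T i (Suc i)\<close> these are the three existing edges of their level.\<close>

lemma labelled_edge_Tsup:
  assumes "1 \<le> i" "i < n"
  shows "labelled_edge n \<delta> (Tsup i i) = seg i (g i) (g i)"
    and "labelled_edge n \<delta> (Tsup i (Suc i)) = seg i (\<not> g i) (\<not> g i)"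
  using assms by (auto simp: tile_sides simp del: tile.simps glue_right.simps)

lemma labelled_edge_T_middle:
  assumes "1 \<le> i" "i < n"
  shows "labelled_edge n \<delta> (T i (Suc i)) = seg i (g i) (\<not> g i)"
  using assms by (auto simp: tile_sides simp del: tile.simps glue_right.simps)

lemma labelled_edge_T_first:
  assumes "j = 0 \<or> j = 1"
  shows "labelled_edge n \<delta> (T 1 j) = seg 0 True (j = \<delta> 1)"
    and "labelled_edge n \<delta> (T (Suc 0) j) = seg 0 True (j = \<delta> 1)"
  using assms two_le_n by (auto simp: tile_sides simp del: tile.simps)

lemma labelled_edge_T_last:
  assumes "j = 0 \<or> j = 1"
  shows "labelled_edge n \<delta> (T n j) = seg n (g (n - 1) = (j = \<delta> (n - 1))) True"
  using assms two_le_n by (auto simp: tile_sides simp del: tile.simps glue_right.simps)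

lemmas labelled_edge_eq =
  labelled_edge_Tsup labelled_edge_T_middle labelled_edge_T_first labelled_edge_T_last

text \<open>This makes \<open>inv_into\<close> in \<open>edge_weight\<close> return the intended
  label. Labels of different levels carry different edges, and within one level there are at most
  three to compare.\<close>

lemma labelled_edge_inj: "inj_on (labelled_edge n \<delta>) (labels n)"
proof (rule inj_onI)
  define strip where "strip i = (if i = 0 then {T 1 0, T 1 1} else if i = n then {T n 0, T n 1}
    else {Tsup i i, Tsup i (Suc i), T i (Suc i)})" for i
  have ex_strip: "\<exists>i\<le>n. l \<in> strip i" if "l \<in> labels n" for l
  proof -
    have "l \<in> strip 0 \<or> l \<in> strip n \<or> (\<exists>i\<in>{1..<n}. l \<in> strip i)"
      using that two_le_n by (auto simp: labels_def strip_def)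
    moreover have "0 \<le> n" "\<And>i. i \<in> {1..<n} \<Longrightarrow> i \<le> n" by auto
    ultimately show ?thesis by blast
  qed
  have edge: "\<exists>p q. labelled_edge n \<delta> l = seg i p q" if l: "l \<in> strip i" and i: "i \<le> n" for l i
  proof -
    consider "i = 0" | "i = n" "i \<noteq> 0" | "1 \<le> i" "i < n" using i by linarith
    then show ?thesis
      using l by cases (auto simp: strip_def labelled_edge_eq simp del: labelled_edge.simps)
  qed
  have strip_inj: "l = l'"
    if l: "l \<in> strip i" "l' \<in> strip i" and i: "i \<le> n" and eq: "labelled_edge n \<delta> l = labelled_edge n \<delta> l'" for l l' i
  proof -
    consider "i = 0" | "i = n" "i \<noteq> 0" | "1 \<le> i" "i < n" using i by linarith
    then show ?thesis
      using l eq two_le_n delta_cases[of 1] delta_cases[of "n - 1"]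
      by cases (auto simp: strip_def labelled_edge_eq simp del: labelled_edge.simps)
  qed
  fix l l' assume "l \<in> labels n" "l' \<in> labels n" and eq: "labelled_edge n \<delta> l = labelled_edge n \<delta> l'"
  then obtain i j where ij: "i \<le> n" "j \<le> n" "l \<in> strip i" "l' \<in> strip j"
    using ex_strip by metis
  then have "i = j" using edge eq by (metis seg_eq_iff)
  then show "l = l'" using strip_inj ij eq by blast
qed

lemma edge_weight_labelled_edge:
  "l \<in> labels n \<Longrightarrow> edge_weight n \<delta> (labelled_edge n \<delta> l) = label_weight l"
  by (simp add: edge_weight_def inv_into_f_f[OF labelled_edge_inj])

section \<open>Perfect matchings as admissible bit sequences\<close>

definition admissible :: "(nat \<Rightarrow> bool) \<Rightarrow> bool" where
  "admissible s \<longleftrightarrow> (\<forall>i\<in>{1..<n}. \<not> (s i = g i \<and> s (Suc i) = g i))"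

text \<open>The vertex \<open>s i\<close> of level \<open>i\<close> is already covered from below,
  so the edge going up has to start at the other one.\<close>

definition path_edge :: "(nat \<Rightarrow> bool) \<Rightarrow> nat \<Rightarrow> edge" where
  "path_edge s i = seg i (\<not> s i) (s (Suc i))"

definition path_matching :: "(nat \<Rightarrow> bool) \<Rightarrow> edge set" where
  "path_matching s = path_edge s ` {0..n}"

lemma seg_in_path_matching_iff:
  "i \<le> n \<Longrightarrow> seg i p q \<in> path_matching s \<longleftrightarrow> (i = 0 \<or> p = (\<not> s i)) \<and> (i = n \<or> q = s (Suc i))"
  by (auto simp: path_matching_def path_edge_def image_iff)

lemma path_matching_in_snake_matchings:
  assumes "admissible s"
  shows "path_matching s \<in> snake_matchings n \<delta>"
  unfolding snake_matchings_def perfect_matchings_def snake_verts_eq snake_edges_eq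
proof (intro CollectI conjI ballI)
  show "path_matching s \<subseteq> {seg i p q |i p q. i \<le> n \<and> (p = g i \<or> q = (\<not> g i) \<or> i = 0 \<or> i = n)}"
  proof
    fix e assume "e \<in> path_matching s"
    then obtain i where i: "i \<le> n" "e = seg i (\<not> s i) (s (Suc i))"
      by (auto simp: path_matching_def path_edge_def)
    moreover have "(\<not> s i) = g i \<or> s (Suc i) = (\<not> g i) \<or> i = 0 \<or> i = n"
      using assms i(1) by (auto simp: admissible_def)
    ultimately show "e \<in> {seg i p q |i p q. i \<le> n \<and> (p = g i \<or> q = (\<not> g i) \<or> i = 0 \<or> i = n)}"
      by blast
  qed
next
  fix x assume "x \<in> {vert i p |i p. i \<le> Suc n}"
  then obtain i p where i: "i \<le> Suc n" and x: "x = vert i p" by auto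
  \<comment> \<open>The vertex is covered from above if it is the bottom vertex or differs from
    \<open>s i\<close>, and from below otherwise; the top vertex falls under the second
    case.\<close>
  define j where "j = (if i = 0 \<or> i \<le> n \<and> p = (\<not> s i) then i else i - 1)"
  show "\<exists>!e. e \<in> path_matching s \<and> x \<in> e"
  proof
    show "path_edge s j \<in> path_matching s \<and> x \<in> path_edge s j"
    proof
      have "j \<le> n" using i by (auto simp: j_def)
      then show "path_edge s j \<in> path_matching s" by (auto simp: path_matching_def)
      show "x \<in> path_edge s j" using i x by (auto simp: path_edge_def j_def)
    qed
  next
    fix e assume "e \<in> path_matching s \<and> x \<in> e"
    then obtain k where "k \<le> n" "e = path_edge s k" "x \<in> path_edge s k"
      by (auto simp: path_matching_def)
    then show "e = path_edge s j"
      using i x by (auto simp: path_edge_def j_def)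
  qed
qed

text \<open>Climbing the levels: once a single edge arrives at level \<open>i\<close>, the vertex it
  misses must be matched upwards, while the vertex it hits admits no further edge. So again a single
  edge leaves level \<open>i\<close>.\<close>

lemma snake_matching_is_path_matching:
  assumes "\<gamma> \<in> snake_matchings n \<delta>"
  obtains s where "admissible s" "\<gamma> = path_matching s"
proof -
  have sub: "\<exists>i p q. e = seg i p q \<and> i \<le> n \<and> (p = g i \<or> q = (\<not> g i) \<or> i = 0 \<or> i = n)"
    if "e \<in> \<gamma>" for e
    using assms that by (auto simp: snake_matchings_def perfect_matchings_def snake_edges_eq)
  have ex1: "\<exists>!e. e \<in> \<gamma> \<and> vert i p \<in> e" if "i \<le> Suc n" for i p
  proof -
    have "vert i p \<in> snake_verts n \<delta>" using that by (auto simp: snake_verts_eq)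
    then show ?thesis
      using assms unfolding snake_matchings_def perfect_matchings_def by blast
  qed
  have uniq: "e = e'" if "e \<in> \<gamma>" "e' \<in> \<gamma>" "vert i p \<in> e" "vert i p \<in> e'" "i \<le> Suc n" for i p e e'
    using ex1[of i p] that by blast
  \<comment> \<open>The bit is read off the matching edge arriving from below, whose lower end is
    left open. The values at \<open>0\<close> and \<open>Suc n\<close> are immaterial.\<close>
  define s where "s i \<longleftrightarrow> (\<exists>p. seg (i - 1) p True \<in> \<gamma>)" for i
  have step: "\<And>p q. seg i p q \<in> \<gamma> \<longleftrightarrow> seg i p q = path_edge s i" if "i \<le> n" for i
    using that
  proof (induction i)
    case 0
    obtain e where e: "e \<in> \<gamma>" "vert 0 True \<in> e" using ex1[of 0 True] by auto
    obtain k p q0 where "e = seg k p q0" "k \<le> n" using sub[OF e(1)] by auto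
    then have q0: "e = seg 0 True q0" using e(2) by auto
    have *: "seg 0 p q \<in> \<gamma> \<longleftrightarrow> seg 0 p q = e" for p q
      using uniq[OF _ e(1) _ e(2)] e(1) by auto
    then have "s (Suc 0) = q0" using two_le_n by (auto simp: s_def q0)
    then show ?case using * q0 by (auto simp: path_edge_def)
  next
    case (Suc i)
    let ?j = "Suc i"
    have prev: "path_edge s i \<in> \<gamma>"
      using Suc.IH[of "\<not> s i" "s ?j"] Suc.prems by (auto simp: path_edge_def)
    obtain e where e: "e \<in> \<gamma>" "vert ?j (\<not> s ?j) \<in> e" using ex1[of ?j "\<not> s ?j"] Suc.prems by auto
    then obtain k p q0 where k: "e = seg k p q0" "k \<le> n" using sub[OF e(1)] by auto
    \<comment> \<open>By induction the only matching edge from below is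
      \<open>path_edge s i\<close>, which ends at the opposite vertex.\<close>
    have "k \<noteq> i"
      using Suc.IH[of p q0] e k Suc.prems by (auto simp: path_edge_def)
    then have q0: "e = seg ?j (\<not> s ?j) q0" using e k Suc.prems by auto
    have *: "seg ?j p q \<in> \<gamma> \<longleftrightarrow> seg ?j p q = e" for p q
    proof
      assume h: "seg ?j p q \<in> \<gamma>"
      show "seg ?j p q = e"
      proof (cases "p = s ?j")
        case True
        \<comment> \<open>Both edges cover the vertex \<open>s ?j\<close>; since they lie at
          different levels, this case is contradictory.\<close>
        then have "seg ?j p q = path_edge s i"
          using uniq[OF h prev, of ?j p] Suc.prems by (auto simp: path_edge_def)
        then show ?thesis using Suc.prems by (auto simp: path_edge_def)
      next
        case False
        then show ?thesis
          using uniq[OF h e(1) _ e(2)] Suc.prems by auto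
      qed
    qed (use e in simp)
    have "?j = n \<or> s (Suc ?j) = q0"
      using Suc.prems by (auto simp: s_def q0 *)
    then show ?case using * q0 Suc.prems by (auto simp: path_edge_def)
  qed
  have mem: "path_edge s i \<in> \<gamma>" if "i \<le> n" for i
    using step[OF that, of "\<not> s i" "s (Suc i)"] by (simp add: path_edge_def)
  have "\<gamma> = path_matching s"
  proof (intro equalityI subsetI)
    fix e assume "e \<in> \<gamma>"
    with sub[OF this] show "e \<in> path_matching s"
      using step by (auto simp: path_matching_def)
  qed (auto simp: path_matching_def mem)
  moreover have "admissible s"
    unfolding admissible_def
  proof (intro ballI notI)
    fix i assume i: "i \<in> {1..<n}" and h: "s i = g i \<and> s (Suc i) = g i"
    with sub[OF mem, of i] show False by (auto simp: path_edge_def)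
  qed
  ultimately show ?thesis using that by blast
qed

section \<open>GCCs as admissible bit sequences\<close>

text \<open>Index \<open>1 + \<delta> i\<close> looks at the lower level \<open>i\<close> and index
  \<open>2 - \<delta> i\<close> at the upper level \<open>Suc i\<close>; these are the indices in
  the compatibility conditions and in the conditions at both ends.\<close>

definition path_gcc :: "(nat \<Rightarrow> 'e) \<Rightarrow> (nat \<Rightarrow> 'e) \<Rightarrow> (nat \<Rightarrow> bool) \<Rightarrow> nat \<times> nat \<Rightarrow> 'e set" where
  "path_gcc u v s = (\<lambda>(i, r)\<in>{1..<n} \<times> {1, 2}.
     if (if r = 1 + \<delta> i then s i = g i else s (Suc i) = g i)
     then (if r = 1 then {u i} else {v i}) else {})"

lemma card_path_gcc:
  assumes "1 \<le> i" "i < n"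
  shows "card (path_gcc u v s (i, 1)) =
      (if (if \<delta> i = 0 then s i = g i else s (Suc i) = g i) then 1 else 0)"
    and "card (path_gcc u v s (i, 2)) =
      (if (if \<delta> i = 0 then s (Suc i) = g i else s i = g i) then 1 else 0)"
  using assms delta_cases[of i] by (auto simp: path_gcc_def)

text \<open>The simplifier turns the index \<open>1\<close> into \<open>Suc 0\<close>.\<close>

lemmas card_path_gcc_Suc_0 = card_path_gcc(1)[unfolded One_nat_def]

lemma glue_right_step:
  "1 \<le> i \<Longrightarrow> g (Suc i) \<longleftrightarrow> (if \<delta> i \<noteq> \<delta> (Suc i) then g i else \<not> g i)"
  by (cases i) auto

text \<open>The four compatibility conditions become a single one, with the index shifted down by
  one. In the bit encoding both sets compared there test the bit of level
  \<open>Suc i\<close>.\<close>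

lemma gccs_iff:
  "S \<in> gccs n \<delta> u v \<longleftrightarrow> S \<in> collections n u v \<and>
     (\<forall>i\<in>{1..<n}. (card (S (i, 1)), card (S (i, 2))) \<noteq> (1, 1)) \<and>
     (\<forall>i\<in>{1..<n - 1}. card (S (i, 2 - \<delta> i)) = card (S (Suc i, 1 + \<delta> (Suc i))) \<longleftrightarrow>
        \<delta> i \<noteq> \<delta> (Suc i))"
proof -
  have "{1..n-1} = {1..<n}" "{2..n-1} = Suc ` {1..<n - 1}"
    using two_le_n by (auto simp: image_Suc_atLeastLessThan)
  moreover have "((\<delta> i, \<delta> (Suc i)) = (0, 0) \<longrightarrow> card (S (i, 2)) \<noteq> card (S (Suc i, 1))) \<and>
      ((\<delta> i, \<delta> (Suc i)) = (1, 1) \<longrightarrow> card (S (i, 1)) \<noteq> card (S (Suc i, 2))) \<and>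
      ((\<delta> i, \<delta> (Suc i)) = (0, 1) \<longrightarrow> card (S (i, 2)) = card (S (Suc i, 2))) \<and>
      ((\<delta> i, \<delta> (Suc i)) = (1, 0) \<longrightarrow> card (S (i, 1)) = card (S (Suc i, 1))) \<longleftrightarrow>
      (card (S (i, 2 - \<delta> i)) = card (S (Suc i, 1 + \<delta> (Suc i))) \<longleftrightarrow> \<delta> i \<noteq> \<delta> (Suc i))" for i
    using delta_cases[of i] delta_cases[of "Suc i"] by (elim disjE) (simp_all flip: numeral_2_eq_2)
  ultimately show ?thesis
    by (simp only: gccs_def mem_Collect_eq ball_simps diff_Suc_1)
qed

text \<open>The excluded pair \<open>(1, 1)\<close> is admissibility. For compatibility,
  \<open>s (Suc i)\<close> is compared with \<open>g i\<close> and with \<open>g (Suc i)\<close>,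
  which agree exactly when \<open>\<delta> i \<noteq> \<delta> (Suc i)\<close>.\<close>

lemma path_gcc_in_gccs:
  assumes "admissible s"
  shows "path_gcc u v s \<in> gccs n \<delta> u v"
  unfolding gccs_iff
proof (intro conjI ballI)
  show "path_gcc u v s \<in> collections n u v"
    by (auto simp: path_gcc_def collections_def restrict_PiE_iff)
next
  fix i assume "i \<in> {1..<n}"
  then show "(card (path_gcc u v s (i, 1)), card (path_gcc u v s (i, 2))) \<noteq> (1, 1)"
    using assms by (auto simp: card_path_gcc card_path_gcc_Suc_0 admissible_def)
next
  fix i assume "i \<in> {1..<n - 1}"
  then have i: "1 \<le> i" "i < n" "1 \<le> Suc i" "Suc i < n" by auto
  have "card (path_gcc u v s (i, 2 - \<delta> i)) = (if s (Suc i) = g i then 1 else 0)"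
    using i delta_cases[of i] card_path_gcc[of i u v s] by auto
  moreover have "card (path_gcc u v s (Suc i, 1 + \<delta> (Suc i))) =
      (if s (Suc i) = g (Suc i) then 1 else 0)"
    using i delta_cases[of "Suc i"] card_path_gcc[of "Suc i" u v s]
    by (elim disjE) (auto simp flip: numeral_2_eq_2)
  ultimately show "card (path_gcc u v s (i, 2 - \<delta> i)) = card (path_gcc u v s (Suc i, 1 + \<delta> (Suc i)))
      \<longleftrightarrow> \<delta> i \<noteq> \<delta> (Suc i)"
    using i glue_right_step[of i] by auto
qed

text \<open>A bit at a level strictly between \<open>1\<close> and \<open>n\<close> can be read off
  two neighbouring sets, and compatibility says that both readings agree.\<close>

lemma gcc_is_path_gcc:
  assumes "S \<in> gccs n \<delta> u v"
  obtains s where "admissible s" "S = path_gcc u v s"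
proof -
  have S: "S \<in> collections n u v"
    and excl: "\<And>i. 1 \<le> i \<Longrightarrow> i < n \<Longrightarrow> \<not> (card (S (i, 1)) = 1 \<and> card (S (i, 2)) = 1)"
    and comp: "\<And>i. 1 \<le> i \<Longrightarrow> i < n - 1 \<Longrightarrow>
      card (S (i, 2 - \<delta> i)) = card (S (Suc i, 1 + \<delta> (Suc i))) \<longleftrightarrow> \<delta> i \<noteq> \<delta> (Suc i)"
    using assms unfolding gccs_iff by auto
  have sub: "S (i, 1) \<subseteq> {u i}" "S (i, 2) \<subseteq> {v i}" if "1 \<le> i" "i < n" for i
    using PiE_mem[OF S[unfolded collections_def], of "(i, 1)"]
      PiE_mem[OF S[unfolded collections_def], of "(i, 2)"] that by auto
  have sing: "X = {} \<and> card X = 0 \<or> X = {x} \<and> card X = 1" if "X \<subseteq> {x}" for X and x :: 'e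
    using that by (auto simp: subset_singleton_iff)
  have le1: "card (S (i, r)) = 0 \<or> card (S (i, r)) = 1" if "1 \<le> i" "i < n" "r \<in> {1, 2}" for i r
    using sing[OF sub(1)[OF that(1,2)]] sing[OF sub(2)[OF that(1,2)]] that(3) by blast
  \<comment> \<open>This solves \<open>s i = g i \<longleftrightarrow> card (S (i, 1 + \<delta> i))
    = 1\<close> for \<open>s i\<close>. No sets are indexed by \<open>n\<close>, so the bit of level
    \<open>n\<close> is taken from the upper set at \<open>n - 1\<close>.\<close>
  define s where "s i \<longleftrightarrow> (if i < n then g i = (card (S (i, 1 + \<delta> i)) = 1)
     else g (n - 1) = (card (S (n - 1, 2 - \<delta> (n - 1))) = 1))" for i
  have s1: "s i = g i \<longleftrightarrow> card (S (i, 1 + \<delta> i)) = 1" if "1 \<le> i" "i < n" for i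
    using that by (auto simp: s_def)
  have s2: "s (Suc i) = g i \<longleftrightarrow> card (S (i, 2 - \<delta> i)) = 1" if i: "1 \<le> i" "i < n" for i
  proof (cases "Suc i = n")
    case True
    then show ?thesis by (auto simp: s_def)
  next
    case False
    have "2 - \<delta> i \<in> {1, 2}" "1 + \<delta> (Suc i) \<in> {1, 2}"
      using delta_cases[of i] delta_cases[of "Suc i"] by auto
    then have "card (S (i, 2 - \<delta> i)) \<in> {0, 1}" "card (S (Suc i, 1 + \<delta> (Suc i))) \<in> {0, 1}"
      using le1[of i "2 - \<delta> i"] le1[of "Suc i" "1 + \<delta> (Suc i)"] False i by simp_all
    moreover have "s (Suc i) = g (Suc i) \<longleftrightarrow> card (S (Suc i, 1 + \<delta> (Suc i))) = 1"
      using s1[of "Suc i"] False i by simp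
    moreover have "card (S (i, 2 - \<delta> i)) = card (S (Suc i, 1 + \<delta> (Suc i))) \<longleftrightarrow> g (Suc i) = g i"
      using comp[of i] glue_right_step[of i] False i by auto
    ultimately show ?thesis
      by (metis insertE singletonD zero_neq_one)
  qed
  have cond: "card (S (i, r)) = 1 \<longleftrightarrow> (if r = 1 + \<delta> i then s i = g i else s (Suc i) = g i)"
    if "1 \<le> i" "i < n" "r = 1 \<or> r = 2" for i r
  proof -
    have "r = 1 + \<delta> i \<or> r \<noteq> 1 + \<delta> i \<and> r = 2 - \<delta> i"
      using that(3) delta_cases[of i] by auto
    then show ?thesis using s1 s2 that by auto
  qed
  have "S = path_gcc u v s"
  proof
    fix x :: "nat \<times> nat"
    obtain i r where x: "x = (i, r)" by fastforce
    show "S x = path_gcc u v s x"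
    proof (cases "x \<in> {1..<n} \<times> {1, 2}")
      case True
      then have i: "1 \<le> i" "i < n" "r = 1 \<or> r = 2" using x by auto
      have "S (i, r) = (if card (S (i, r)) = 1 then (if r = 1 then {u i} else {v i}) else {})"
        using sing[OF sub(1)[OF i(1,2)]] sing[OF sub(2)[OF i(1,2)]] i(3) by (elim disjE) auto
      then show ?thesis
        using True unfolding x cond[OF i] by (simp add: path_gcc_def)
    next
      case False
      then show ?thesis
        \<comment> \<open>Outside the index set both functions are \<open>undefined\<close>.\<close>
        using PiE_arb[OF S[unfolded collections_def] False] by (simp only: path_gcc_def restrict_def if_False)
    qed
  qed
  moreover have "admissible s"
    unfolding admissible_def
  proof
    fix i assume "i \<in> {1..<n}"
    then show "\<not> (s i = g i \<and> s (Suc i) = g i)"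
      using excl[of i] cond[of i 1] cond[of i 2] by (auto split: if_splits)
  qed
  ultimately show ?thesis using that by blast
qed

section \<open>Both maps on bit sequences\<close>

text \<open>The edge of \<open>Tsup i i\<close> also requires \<open>s i \<noteq> g i\<close>, and
  that of \<open>Tsup i (i + 1)\<close> requires \<open>s (Suc i) \<noteq> g i\<close>;
  admissibility supplies both.\<close>

lemma matching_cards_path_matching:
  assumes "admissible s" "1 \<le> i" "i < n"
  shows "matching_cards n \<delta> (path_matching s) i =
    (if s (Suc i) = g i then (\<delta> i, 1 - \<delta> i) else if s i = g i then (1 - \<delta> i, \<delta> i) else (0, 0))"
  using assms unfolding matching_cards_def
  by (auto simp: labelled_edge_Tsup seg_in_path_matching_iff admissible_def
      simp del: labelled_edge.simps)

lemma psi_MG_path_matching: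
  assumes "admissible s"
  shows "psi_MG n \<delta> u v (path_matching s) = path_gcc u v s"
proof -
  have "(if r = 1 then if fst (matching_cards n \<delta> (path_matching s) i) = 1 then {u i} else {}
      else if snd (matching_cards n \<delta> (path_matching s) i) = 1 then {v i} else {}) =
    (if if r = 1 + \<delta> i then s i = g i else s (Suc i) = g i
     then if r = 1 then {u i} else {v i} else {})" if ir: "(i, r) \<in> {1..<n} \<times> {1, 2}" for i r
  proof -
    have i: "1 \<le> i" "i < n" "r = 1 \<or> r = 2" using ir by auto
    define a b where ab: "a \<longleftrightarrow> s i = g i" "b \<longleftrightarrow> s (Suc i) = g i"
    have "\<not> (a \<and> b)" using assms i by (auto simp: admissible_def ab)
    then show ?thesis
      unfolding matching_cards_path_matching[OF assms i(1,2)] ab[symmetric]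
      using i(3) delta_cases[of i] by (cases a; cases b; auto)
  qed
  then show ?thesis
    unfolding psi_MG_def path_gcc_def
    by (intro restrict_ext) (simp only: split_paired_all case_prod_conv)
qed

lemma matching_edge_path_gcc:
  assumes "admissible s" "i \<le> n"
  shows "matching_edge n \<delta> (path_gcc u v s) i = path_edge s i"
proof -
  consider "i = 0" | "i = n" "i \<noteq> 0" | "1 \<le> i" "i < n" using assms(2) by linarith
  then show ?thesis
  proof cases
    case 1
    \<comment> \<open>Since \<open>g 1\<close> is true, the cardinality tested here determines
      \<open>s 1\<close> directly.\<close>
    then show ?thesis
      using two_le_n delta_cases[of 1] card_path_gcc[of 1 u v s]
      by (auto simp: matching_edge_def path_edge_def labelled_edge_T_first
          simp del: labelled_edge.simps split: if_splits simp flip: numeral_2_eq_2)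
  next
    case 2
    then show ?thesis
      using two_le_n delta_cases[of "n - 1"] card_path_gcc[of "n - 1" u v s]
      by (auto simp: matching_edge_def path_edge_def labelled_edge_T_last
          simp del: labelled_edge.simps split: if_splits)
  next
    case 3
    \<comment> \<open>In terms of \<open>a\<close> and \<open>b\<close>, which are not both true,
      the three remaining cases are the three labels of this level.\<close>
    define a b where ab: "a \<longleftrightarrow> s i = g i" "b \<longleftrightarrow> s (Suc i) = g i"
    have excl: "\<not> (a \<and> b)" using assms(1) 3 by (auto simp: admissible_def ab)
    have path: "path_edge s i = seg i (a \<noteq> g i) (b = g i)"
      unfolding path_edge_def ab by (cases "s i"; cases "s (Suc i)"; cases "g i"; simp)
    have lab: "matching_edge n \<delta> (path_gcc u v s) i = labelled_edge n \<delta>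
        (if b then Tsup i i else if a then Tsup i (Suc i) else T i (Suc i))"
      using 3 excl delta_cases[of i] unfolding matching_edge_def card_path_gcc[OF 3] ab[symmetric]
      by (cases a; cases b; auto simp del: labelled_edge.simps)
    show ?thesis
      using excl unfolding path lab
      by (cases a; cases b; cases "g i"; simp add: labelled_edge_Tsup[OF 3]
          labelled_edge_T_middle[OF 3] del: labelled_edge.simps)
  qed
qed

lemma psi_GM_path_gcc: "admissible s \<Longrightarrow> psi_GM n \<delta> (path_gcc u v s) = path_matching s"
  unfolding psi_GM_def path_matching_def by (intro image_cong) (auto simp: matching_edge_path_gcc)

section \<open>Weights and transfer to matchings and GCCs\<close>

text \<open>This ensures that the final default branch of \<open>matching_edge\<close> at inner
  indices is really the case \<open>(0, 0)\<close>.\<close>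

lemma gcc_cards:
  assumes "S \<in> gccs n \<delta> u v" "1 \<le> i" "i < n"
  shows "(card (S (i, 1)), card (S (i, 2))) \<in> {(\<delta> i, 1 - \<delta> i), (1 - \<delta> i, \<delta> i), (0, 0)}"
proof -
  obtain s where "admissible s" and S: "S = path_gcc u v s" using gcc_is_path_gcc[OF assms(1)] .
  then have "\<not> (s i = g i \<and> s (Suc i) = g i)" using assms by (auto simp: admissible_def)
  then show ?thesis
    using assms(2,3) delta_cases[of i] by (auto simp: S card_path_gcc card_path_gcc_Suc_0)
qed

text \<open>At inner indices exactly one of the three exponents in \<open>gcc_y\<close> is 1, and
  its variable is the one of the chosen label. At the ends both sides branch on the same
  condition.\<close>

lemma edge_weight_matching_edge:
  assumes "S \<in> gccs n \<delta> u v" "i \<le> n"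
  shows "edge_weight n \<delta> (matching_edge n \<delta> S i) = gcc_y n \<delta> S i"
proof -
  consider "i = 0" | "i = n" "i \<noteq> 0" | "1 \<le> i" "i < n" using assms(2) by linarith
  then show ?thesis
  proof cases
    case 3
    then show ?thesis
      using gcc_cards[OF assms(1) 3] delta_cases[of i]
      by (auto simp: matching_edge_def gcc_y_def edge_weight_labelled_edge labels_def
          simp del: labelled_edge.simps)
  qed (auto simp: matching_edge_def gcc_y_def edge_weight_labelled_edge labels_def
      simp del: labelled_edge.simps)
qed

text \<open>This shows that the nested conditional in \<open>matching_cards\<close> is a genuine
  case distinction, exclusive and exhaustive.\<close>

lemma ex1_label_in_snake_matching:
  assumes "\<gamma> \<in> snake_matchings n \<delta>" "1 \<le> i" "i < n"
  shows "\<exists>!l. l \<in> {Tsup i i, Tsup i (i + 1), T i (i + 1)} \<and> labelled_edge n \<delta> l \<in> \<gamma>"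
proof -
  obtain s where "admissible s" and \<gamma>: "\<gamma> = path_matching s"
    using snake_matching_is_path_matching[OF assms(1)] .
  then have "s i \<noteq> g i \<or> s (Suc i) \<noteq> g i" using assms by (auto simp: admissible_def)
  then show ?thesis
    using assms(2,3) unfolding \<gamma>
    by (auto simp: labelled_edge_Tsup labelled_edge_T_middle seg_in_path_matching_iff Ex1_def
        conj_disj_distribR ex_disj_distrib simp del: labelled_edge.simps)
qed

lemma psi_MG_in_gccs: "\<gamma> \<in> snake_matchings n \<delta> \<Longrightarrow> psi_MG n \<delta> u v \<gamma> \<in> gccs n \<delta> u v"
  by (metis path_gcc_in_gccs psi_MG_path_matching snake_matching_is_path_matching)

lemma psi_GM_in_snake_matchings:
  "S \<in> gccs n \<delta> u v \<Longrightarrow> psi_GM n \<delta> S \<in> snake_matchings n \<delta>"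
  by (metis gcc_is_path_gcc path_matching_in_snake_matchings psi_GM_path_gcc)

lemma psi_GM_psi_MG: "\<gamma> \<in> snake_matchings n \<delta> \<Longrightarrow> psi_GM n \<delta> (psi_MG n \<delta> u v \<gamma>) = \<gamma>"
  by (metis psi_GM_path_gcc psi_MG_path_matching snake_matching_is_path_matching)

lemma psi_MG_psi_GM: "S \<in> gccs n \<delta> u v \<Longrightarrow> psi_MG n \<delta> u v (psi_GM n \<delta> S) = S"
  by (metis gcc_is_path_gcc psi_GM_path_gcc psi_MG_path_matching)

text \<open>The chosen edges lie at different levels, so a product over the set of edges is a
  product over the indices.\<close>

lemma inj_on_matching_edge:
  assumes "S \<in> gccs n \<delta> u v"
  shows "inj_on (matching_edge n \<delta> S) {0..n}"
proof -
  obtain s where s: "admissible s" "S = path_gcc u v s" using gcc_is_path_gcc[OF assms] .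
  have "inj_on (path_edge s) {0..n}" by (auto simp: inj_on_def path_edge_def)
  then show ?thesis
    using s by (subst inj_on_cong[of _ _ "path_edge s"]) (auto simp: matching_edge_path_gcc)
qed

lemma prod_edge_weight_psi_GM:
  assumes "S \<in> gccs n \<delta> u v"
  shows "(\<Prod>e\<in>psi_GM n \<delta> S. edge_weight n \<delta> e) = (\<Prod>i=0..n. gcc_y n \<delta> S i)"
  unfolding psi_GM_def prod.reindex[OF inj_on_matching_edge[OF assms]]
  by (intro prod.cong) (auto simp: edge_weight_matching_edge[OF assms])

lemma sum_matchings_eq_sum_gccs:
  "(\<Sum>\<gamma>\<in>snake_matchings n \<delta>. \<Prod>e\<in>\<gamma>. edge_weight n \<delta> e) =
     (\<Sum>S\<in>gccs n \<delta> u v. \<Prod>i=0..n. gcc_y n \<delta> S i)"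
proof (rule sum.reindex_bij_witness[of _ "psi_GM n \<delta>" "psi_MG n \<delta> u v"])
  fix \<gamma> assume \<gamma>: "\<gamma> \<in> snake_matchings n \<delta>"
  show "(\<Prod>i=0..n. gcc_y n \<delta> (psi_MG n \<delta> u v \<gamma>) i) = (\<Prod>e\<in>\<gamma>. edge_weight n \<delta> e)"
    using prod_edge_weight_psi_GM[OF psi_MG_in_gccs[OF \<gamma>]] psi_GM_psi_MG[OF \<gamma>] by metis
qed (simp_all add: psi_MG_in_gccs psi_GM_in_snake_matchings psi_GM_psi_MG psi_MG_psi_GM)

end

theorem theorem5p4:
  fixes n :: nat
    and Q Q' :: "(qvertex, 'a) pre_digraph"
    and u v :: "nat \<Rightarrow> 'e"
    and \<delta> :: "nat \<Rightarrow> nat"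
    and M :: "edge set set"
    and G :: "(nat \<times> nat \<Rightarrow> 'e set) set"
  assumes "n \<ge> 2"
    and "completely_extended_linear_quiver n Q Q'"
    and "\<delta> = delta Q"
    and "M = snake_matchings n \<delta>"
    and "G = gccs n \<delta> u v"
  shows "(\<forall>\<gamma>\<in>M. \<forall>i\<in>{1..n-1}. \<exists>!l. l \<in> {Tsup i i, Tsup i (i + 1), T i (i + 1)} \<and>
              labelled_edge n \<delta> l \<in> \<gamma>) \<and>
         (\<forall>S\<in>G. \<forall>i\<in>{1..n-1}. (card (S (i, 1)), card (S (i, 2))) \<in>
              {(\<delta> i, 1 - \<delta> i), (1 - \<delta> i, \<delta> i), (0, 0)}) \<and>
         (\<forall>\<gamma>\<in>M. psi_MG n \<delta> u v \<gamma> \<in> G) \<and>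
         (\<forall>S\<in>G. psi_GM n \<delta> S \<in> M) \<and>
         (\<forall>\<gamma>\<in>M. psi_GM n \<delta> (psi_MG n \<delta> u v \<gamma>) = \<gamma>) \<and>
         (\<forall>S\<in>G. psi_MG n \<delta> u v (psi_GM n \<delta> S) = S) \<and>
         (\<forall>S\<in>G. \<forall>i\<in>{0..n}.
              edge_weight n \<delta> (matching_edge n \<delta> S i) = (gcc_y n \<delta> S i :: 'k::comm_ring_1 qpoly)) \<and>
         (\<Sum>\<gamma>\<in>M. \<Prod>e\<in>\<gamma>. edge_weight n \<delta> e) =
           (\<Sum>S\<in>G. \<Prod>i=0..n. (gcc_y n \<delta> S i :: 'k::comm_ring_1 qpoly))"
proof -
  interpret snake_diagram n \<delta>
    using assms(1,3) by unfold_locales (auto simp: delta_def)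
  show ?thesis
    unfolding assms(4,5) using assms(1)
    by (intro conjI ballI ex1_label_in_snake_matching gcc_cards psi_MG_in_gccs
        psi_GM_in_snake_matchings psi_GM_psi_MG psi_MG_psi_GM edge_weight_matching_edge
        sum_matchings_eq_sum_gccs) auto
qed

end
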